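(* For any countably infinite group $\Gamma$ and for any free Borel action $\beta:\Gamma\curvearrowright X$ on a standard Borel space $X$, there exists an injective $\Gamma$-equivariant Borel map $\Psi'_\beta:X\to\operatorname{Free}(\mathcal{C}^\Gamma)$ such that the closure of the set $\Psi'_\beta(X)$ in $\mathcal{C}^\Gamma$ is still contained in $\operatorname{Free}(\mathcal{C}^\Gamma)$.
   Context: $\mathcal{C}=\{0,1\}^{\mathbb{N}}$ is the Cantor set. The Bernoulli $\mathcal{C}$-shift space is $\mathcal{C}^\Gamma$ with the product topology and the left action $L_\delta(\rho)(\gamma)=\rho(\gamma\delta)$ for $\delta,\gamma\in\Gamma$, $\rho\in\mathcal{C}^\Gamma$. Its free part $\operatorname{Free}(\mathcal{C}^\Gamma)$ is the set of all $\rho\in\mathcal{C}^\Gamma$ such that $L_\delta(\rho)=\rho$ implies $\delta=e_\Gamma$. An action is free if no non-identity element of $\Gamma$ fixes a point. *)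

theory Defs
  imports "HOL-Analysis.Analysis" "HOL-Algebra.Group_Action"
begin

definition borel_of :: "'a topology \<Rightarrow> 'a measure" where
  "borel_of T = sigma (topspace T) {U. openin T U}"

definition polish_topology :: "'a topology \<Rightarrow> bool" where
  "polish_topology T \<longleftrightarrow> separable_space T \<and> completely_metrizable_space T"

text \<open>A measurable space is given by a value of type \<^typ>\<open>'a measure\<close>, of which only the
  underlying set and the sigma-algebra are used.\<close>

definition standard_borel :: "'a measure \<Rightarrow> bool" where
  "standard_borel M \<longleftrightarrow> (\<exists>T. polish_topology T \<and> sets M = sets (borel_of T))"

text \<open>The acting group carries the discrete sigma-algebra, so that the whole action map on
  \<open>\<Gamma> \<times> X\<close> is required to be Borel. The locale \<^locale>\<open>group_action\<close> is about
  left actions.\<close>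

definition borel_action :: "('g, 'b) monoid_scheme \<Rightarrow> 'a measure \<Rightarrow> ('g \<Rightarrow> 'a \<Rightarrow> 'a) \<Rightarrow> bool" where
  "borel_action \<Gamma> M \<beta> \<longleftrightarrow>
     group_action \<Gamma> (space M) \<beta> \<and>
     (\<lambda>(\<gamma>, x). \<beta> \<gamma> x) \<in> count_space (carrier \<Gamma>) \<Otimes>\<^sub>M M \<rightarrow>\<^sub>M M"

definition free_action :: "('g, 'b) monoid_scheme \<Rightarrow> 'a set \<Rightarrow> ('g \<Rightarrow> 'a \<Rightarrow> 'a) \<Rightarrow> bool" where
  "free_action \<Gamma> E \<beta> \<longleftrightarrow>
     (\<forall>\<gamma>\<in>carrier \<Gamma>. \<gamma> \<noteq> \<one>\<^bsub>\<Gamma>\<^esub> \<longrightarrow> (\<forall>x\<in>E. \<beta> \<gamma> x \<noteq> x))"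

text \<open>\<^typ>\<open>bool\<close> plays the role of the two-point set \<open>{0, 1}\<close>.\<close>

definition cantor_topology :: "(nat \<Rightarrow> bool) topology" where
  "cantor_topology = product_topology (\<lambda>_. discrete_topology UNIV) UNIV"

text \<open>The points of this space are the functions that are extensional on \<^term>\<open>carrier \<Gamma>\<close>.\<close>

definition bernoulli_topology :: "('g, 'b) monoid_scheme \<Rightarrow> ('g \<Rightarrow> nat \<Rightarrow> bool) topology" where
  "bernoulli_topology \<Gamma> = product_topology (\<lambda>_. cantor_topology) (carrier \<Gamma>)"

definition shift ::
    "('g, 'b) monoid_scheme \<Rightarrow> 'g \<Rightarrow> ('g \<Rightarrow> nat \<Rightarrow> bool) \<Rightarrow> ('g \<Rightarrow> nat \<Rightarrow> bool)" where
  "shift \<Gamma> \<delta> \<rho> = (\<lambda>\<gamma>\<in>carrier \<Gamma>. \<rho> (\<gamma> \<otimes>\<^bsub>\<Gamma>\<^esub> \<delta>))"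

definition free_part :: "('g, 'b) monoid_scheme \<Rightarrow> ('g \<Rightarrow> nat \<Rightarrow> bool) set" where
  "free_part \<Gamma> =
     {\<rho> \<in> topspace (bernoulli_topology \<Gamma>).
        \<forall>\<delta>\<in>carrier \<Gamma>. shift \<Gamma> \<delta> \<rho> = \<rho> \<longrightarrow> \<delta> = \<one>\<^bsub>\<Gamma>\<^esub>}"

end

theory Submission
  imports Defs
begin

text \<open>
  Send a point \<open>x\<close> to the function that records, for each \<open>\<gamma>\<close>, a Cantor-space label of \<open>\<gamma>x\<close>.
  Any Borel labelling \<open>\<Phi>\<close> of \<open>X\<close> yields an equivariant Borel map in this way, and the map is injective as
  soon as \<open>\<Phi>\<close> is, for which it suffices that the bits of \<open>\<Phi>\<close> include membership in each set of
  a countable separating family. What remains is to keep the closure of the image free.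

  Suppose that for each \<open>\<delta> \<noteq> 1\<close> finitely many bits of \<open>\<Phi>\<close> suffice to distinguish \<open>\<delta>x\<close> from \<open>x\<close>, the same
  bits for all \<open>x\<close>. Then \<open>\<rho>(\<delta>)\<close> and \<open>\<rho>(1)\<close> differ in one of these bits for every \<open>\<rho>\<close> in the image. This
  condition is clopen, so it persists in the closure, and there it says that \<open>\<delta>\<close> does not fix \<open>\<rho>\<close>
  (\<open>closure_of_subset_free_part\<close>).

  Such bits are the digits of a Borel colouring with finitely many colours of the graph joining
  \<open>x\<close> to \<open>\<delta>x\<close>. A separating sequence gives a Borel colouring with countably many colours at once
  (\<open>fixed_point_free_countable_colouring\<close>). Its digits are of no direct use, because no finite
  set of them need work for all \<open>x\<close>. But the graph is a union of lines and cycles, and along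
  these a colouring by natural numbers can be compressed to four colours: record whether the colour
  increases or decreases along the next edge, and the parity of the position within the current
  monotone run, counted from the end at which the natural numbers are smallest, which lies at finite
  distance (\<open>invertible_four_colouring\<close>).
\<close>

section \<open>Borel maps into countable products\<close>

text \<open>A box is given by a set of constraints rather than by a family of open sets indexed by \<open>I\<close>,
  because only countably many finite sets of constraints can be formed from countable bases.\<close>

definition product_box :: "('i \<Rightarrow> 'a topology) \<Rightarrow> 'i set \<Rightarrow> ('i \<times> 'a set) set \<Rightarrow> ('i \<Rightarrow> 'a) set" where
  "product_box X I S = {y \<in> topspace (product_topology X I). \<forall>(i, V)\<in>S. y i \<in> V}"

text \<open>The constraints take their open sets from countable bases of the factors. A basic
  neighbourhood in the product topology restricts finitely many coordinates, and each of these
  restrictions can be shrunk to a member of the base.\<close>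

lemma product_topology_countable_box_base:
  assumes I: "countable I"
    and X: "\<forall>i\<in>I. second_countable (X i)"
  shows "\<exists>\<S>. countable \<S> \<and>
    (\<forall>S\<in>\<S>. finite S \<and> S \<subseteq> {(i, V). i \<in> I \<and> openin (X i) V}) \<and>
    (\<forall>U x. openin (product_topology X I) U \<and> x \<in> U \<longrightarrow>
       (\<exists>S\<in>\<S>. x \<in> product_box X I S \<and> product_box X I S \<subseteq> U))"
proof -
  from X have "\<forall>i\<in>I. \<exists>\<B>. countable \<B> \<and> (\<forall>V\<in>\<B>. openin (X i) V) \<and>
      (\<forall>U x. openin (X i) U \<and> x \<in> U \<longrightarrow> (\<exists>V\<in>\<B>. x \<in> V \<and> V \<subseteq> U))"
    by (simp add: second_countable_def)
  then have "\<exists>B. \<forall>i\<in>I. countable (B i) \<and> (\<forall>V\<in>B i. openin (X i) V) \<and>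
      (\<forall>U x. openin (X i) U \<and> x \<in> U \<longrightarrow> (\<exists>V\<in>B i. x \<in> V \<and> V \<subseteq> U))"
    by (rule bchoice)
  then obtain B where B: "\<forall>i\<in>I. countable (B i)" "\<forall>i\<in>I. \<forall>V\<in>B i. openin (X i) V"
      "\<forall>i\<in>I. \<forall>U x. openin (X i) U \<and> x \<in> U \<longrightarrow> (\<exists>V\<in>B i. x \<in> V \<and> V \<subseteq> U)"
    by (simp only: ball_conj_distrib) (elim exE conjE, rule that)
  show ?thesis
  proof (intro exI conjI ballI allI impI)
    show "countable {S. finite S \<and> S \<subseteq> Sigma I B}"
      using countable_Collect_finite_subset[of "Sigma I B"] countable_SIGMA[of I B] I B(1)
      by (simp add: conj_commute)
    show "finite S" "S \<subseteq> {(i, V). i \<in> I \<and> openin (X i) V}"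
      if "S \<in> {S. finite S \<and> S \<subseteq> Sigma I B}" for S
      using that B(2) by auto
    fix U x
    assume xU: "openin (product_topology X I) U \<and> x \<in> U"
    then have "\<exists>V. finite {i \<in> I. V i \<noteq> topspace (X i)} \<and> (\<forall>i\<in>I. openin (X i) (V i)) \<and>
        x \<in> Pi\<^sub>E I V \<and> Pi\<^sub>E I V \<subseteq> U"
      by (simp only: openin_product_topology_alt)
    then obtain V where V: "finite {i \<in> I. V i \<noteq> topspace (X i)}" "\<forall>i\<in>I. openin (X i) (V i)"
        "x \<in> Pi\<^sub>E I V" "Pi\<^sub>E I V \<subseteq> U"
      by (elim exE conjE) (rule that)
    let ?J = "{i \<in> I. V i \<noteq> topspace (X i)}"
    have "\<forall>i\<in>?J. \<exists>W\<in>B i. x i \<in> W \<and> W \<subseteq> V i"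
    proof
      fix i
      assume "i \<in> ?J"
      then have "i \<in> I" "openin (X i) (V i)" "x i \<in> V i"
        using V(2,3) by auto
      with B(3) show "\<exists>W\<in>B i. x i \<in> W \<and> W \<subseteq> V i"
        by simp
    qed
    then obtain W where W: "\<And>i. i \<in> ?J \<Longrightarrow> W i \<in> B i \<and> x i \<in> W i \<and> W i \<subseteq> V i"
      by metis
    let ?S = "(\<lambda>i. (i, W i)) ` ?J"
    have S: "?S \<in> {S. finite S \<and> S \<subseteq> Sigma I B}"
      using V(1) W by auto
    have "x \<in> topspace (product_topology X I)"
      using xU openin_subset by blast
    then have x_box: "x \<in> product_box X I ?S"
      using W unfolding product_box_def by blast
    have "product_box X I ?S \<subseteq> Pi\<^sub>E I V"
    proof (intro subsetI PiE_I)
      fix y i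
      assume "y \<in> product_box X I ?S" "i \<in> I"
      then show "y i \<in> V i"
        using W[of i] by (cases "V i = topspace (X i)") (auto simp: product_box_def PiE_iff)
    qed (auto simp: product_box_def PiE_iff extensional_def)
    then have "product_box X I ?S \<subseteq> U"
      using V(4) by (rule subset_trans)
    with S x_box show "\<exists>S\<in>{S. finite S \<and> S \<subseteq> Sigma I B}.
         x \<in> product_box X I S \<and> product_box X I S \<subseteq> U"
      by (intro bexI[of _ ?S] conjI)
  qed
qed

lemma openin_product_box:
  assumes "finite S" "S \<subseteq> {(i, V). i \<in> I \<and> openin (X i) V}"
  shows "openin (product_topology X I) (product_box X I S)"
proof -
  have "openin (product_topology X I)
     ({y \<in> topspace (product_topology X I). \<forall>p\<in>S. y (fst p) \<in> snd p})"
    using assms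
  proof (induction S)
    case (insert p S)
    have "openin (product_topology X I) {y \<in> topspace (product_topology X I). y (fst p) \<in> snd p}"
      using insert.prems by (intro openin_continuous_map_preimage[OF continuous_map_product_projection]) auto
    then have "openin (product_topology X I)
        ({y \<in> topspace (product_topology X I). y (fst p) \<in> snd p} \<inter>
         {y \<in> topspace (product_topology X I). \<forall>p\<in>S. y (fst p) \<in> snd p})"
      using insert by (intro openin_Int) auto
    then show ?case
      by (rule back_subst[of "openin _"]) auto
  qed (simp del: topspace_product_topology)
  then show ?thesis
    unfolding product_box_def by (simp only: case_prod_unfold)
qed

lemma second_countable_product_topology:
  assumes "countable I" "\<forall>i\<in>I. second_countable (X i)"
  shows "second_countable (product_topology X I)"
proof -
  obtain \<S> where S: "countable \<S>"
    "\<forall>S\<in>\<S>. finite S \<and> S \<subseteq> {(i, V). i \<in> I \<and> openin (X i) V}"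
    "\<forall>U x. openin (product_topology X I) U \<and> x \<in> U \<longrightarrow>
       (\<exists>S\<in>\<S>. x \<in> product_box X I S \<and> product_box X I S \<subseteq> U)"
    using product_topology_countable_box_base[OF assms] by (elim exE conjE) (rule that)
  show ?thesis
    unfolding second_countable_def
  proof (intro exI conjI allI impI ballI)
    let ?\<B> = "product_box X I ` \<S>"
    show "countable ?\<B>"
      using S(1) by simp
    show "openin (product_topology X I) V" if "V \<in> ?\<B>" for V
      using that S(2) by (auto intro!: openin_product_box)
    show "\<exists>V\<in>?\<B>. x \<in> V \<and> V \<subseteq> U" if "openin (product_topology X I) U \<and> x \<in> U" for U x
    proof -
      from S(3) that obtain S where "S \<in> \<S>" "x \<in> product_box X I S \<and> product_box X I S \<subseteq> U"
        by (elim allE[of _ U] allE[of _ x]) (simp, elim bexE, rule that)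
      then show ?thesis
        by (intro bexI[of _ "product_box X I S"] imageI)
    qed
  qed
qed

lemma borel_of_properties:
  shows space_borel_of: "space (borel_of T) = topspace T"
    and openin_imp_sets_borel_of: "openin T U \<Longrightarrow> U \<in> sets (borel_of T)"
  unfolding borel_of_def
  by (auto simp: space_measure_of_conv sets_measure_of_conv dest: openin_subset)

lemma measurable_borel_ofI:
  assumes "f \<in> space M \<rightarrow> topspace T"
    and "\<And>U. openin T U \<Longrightarrow> f -` U \<inter> space M \<in> sets M"
  shows "f \<in> M \<rightarrow>\<^sub>M borel_of T"
  unfolding borel_of_def
  using assms by (intro measurable_measure_of) (auto dest: openin_subset)

text \<open>With a countable base of boxes, the preimage of an open set is a countable union of
  finite intersections of preimages under the coordinates.\<close>

lemma measurable_borel_of_product: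
  assumes I: "countable I" "\<forall>i\<in>I. second_countable (X i)"
    and ext: "\<And>x. x \<in> space M \<Longrightarrow> f x \<in> extensional I"
    and f: "\<And>i. i \<in> I \<Longrightarrow> (\<lambda>x. f x i) \<in> M \<rightarrow>\<^sub>M borel_of (X i)"
  shows "f \<in> M \<rightarrow>\<^sub>M borel_of (product_topology X I)"
proof (rule measurable_borel_ofI)
  have top: "f x \<in> topspace (product_topology X I)" if "x \<in> space M" for x
    using ext[OF that] measurable_space[OF f that] by (auto simp: PiE_iff space_borel_of)
  then show "f \<in> space M \<rightarrow> topspace (product_topology X I)"
    by blast
  obtain \<S> where S: "countable \<S>"
    "\<forall>S\<in>\<S>. finite S \<and> S \<subseteq> {(i, V). i \<in> I \<and> openin (X i) V}"
    "\<forall>U x. openin (product_topology X I) U \<and> x \<in> U \<longrightarrow>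
       (\<exists>S\<in>\<S>. x \<in> product_box X I S \<and> product_box X I S \<subseteq> U)"
    using product_topology_countable_box_base[OF I] by (elim exE conjE) (rule that)
  fix U
  assume U: "openin (product_topology X I) U"
  let ?\<T> = "{S \<in> \<S>. product_box X I S \<subseteq> U}"
  have in_U: "f x \<in> U \<longleftrightarrow> (\<exists>S\<in>?\<T>. f x \<in> product_box X I S)" for x
    using S(3)[rule_format, of U "f x"] U by auto
  have in_box: "f x \<in> product_box X I S \<longleftrightarrow> (\<forall>p\<in>S. f x (fst p) \<in> snd p)" if "x \<in> space M" for x S
    using top[OF that] unfolding product_box_def by (simp only: case_prod_unfold mem_Collect_eq simp_thms)
  have "f -` U \<inter> space M = (\<Union>S\<in>?\<T>. {x \<in> space M. \<forall>p\<in>S. f x (fst p) \<in> snd p})"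
  proof (rule Set.set_eqI)
    show "x \<in> f -` U \<inter> space M \<longleftrightarrow> x \<in> (\<Union>S\<in>?\<T>. {x \<in> space M. \<forall>p\<in>S. f x (fst p) \<in> snd p})" for x
      using in_box[of x] by (cases "x \<in> space M") (simp_all add: in_U)
  qed
  also have "\<dots> \<in> sets M"
  proof (rule sets.countable_UN'')
    show "countable ?\<T>"
      using S(1) by (rule countable_subset[rotated]) blast
    show "{x \<in> space M. \<forall>p\<in>S. f x (fst p) \<in> snd p} \<in> sets M" if "S \<in> ?\<T>" for S
    proof (rule sets.sets_Collect_finite_All)
      show "finite S"
        using that S(2) by blast
      fix p
      assume "p \<in> S"
      then have "fst p \<in> I" "openin (X (fst p)) (snd p)"
        using that S(2) by fastforce+
      then have "(\<lambda>x. f x (fst p)) -` snd p \<inter> space M \<in> sets M"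
        by (intro measurable_sets[OF f] openin_imp_sets_borel_of)
      also have "(\<lambda>x. f x (fst p)) -` snd p \<inter> space M = {x \<in> space M. f x (fst p) \<in> snd p}"
        by auto
      finally show "{x \<in> space M. f x (fst p) \<in> snd p} \<in> sets M" .
    qed
  qed
  finally show "f -` U \<inter> space M \<in> sets M" .
qed

lemma measurable_borel_of_bernoulli:
  assumes \<Gamma>: "countable (carrier \<Gamma>)"
    and ext: "\<And>x. x \<in> space M \<Longrightarrow> f x \<in> extensional (carrier \<Gamma>)"
    and f: "\<And>\<gamma> n. \<gamma> \<in> carrier \<Gamma> \<Longrightarrow> Measurable.pred M (\<lambda>x. f x \<gamma> n)"
  shows "f \<in> M \<rightarrow>\<^sub>M borel_of (bernoulli_topology \<Gamma>)"
  unfolding bernoulli_topology_def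
proof (rule measurable_borel_of_product[OF \<Gamma> _ ext], rule ballI)
  show "second_countable cantor_topology"
    unfolding cantor_topology_def
    by (intro second_countable_product_topology) (auto simp: second_countable_discrete_topology)
  fix \<gamma>
  assume \<gamma>: "\<gamma> \<in> carrier \<Gamma>"
  show "(\<lambda>x. f x \<gamma>) \<in> M \<rightarrow>\<^sub>M borel_of cantor_topology"
    unfolding cantor_topology_def
  proof (rule measurable_borel_of_product)
    show "(\<lambda>x. f x \<gamma> n) \<in> M \<rightarrow>\<^sub>M borel_of (discrete_topology UNIV)" for n
      by (rule measurable_borel_ofI) (simp_all add: measurable_sets[OF f[OF \<gamma>]])
  qed (simp_all add: second_countable_discrete_topology)
qed

section \<open>Borel colourings with four colours\<close>

text \<open>The sets are balls of radius \<open>1/(n+1)\<close> around the points of a countable dense set. The empty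
  set is added because there may be no such point, while the enumeration needs a nonempty family.\<close>

lemma standard_borel_separating_sequence:
  assumes "standard_borel M"
  obtains A :: "nat \<Rightarrow> 'a set" where "\<And>n. A n \<in> sets M"
    and "\<And>x y. \<lbrakk>x \<in> space M; y \<in> space M; x \<noteq> y\<rbrakk> \<Longrightarrow> \<exists>n. (x \<in> A n) \<noteq> (y \<in> A n)"
proof -
  obtain T where T: "separable_space T" "completely_metrizable_space T"
      and sets: "sets M = sets (borel_of T)"
    using assms unfolding standard_borel_def polish_topology_def by (elim exE conjE) (rule that)
  have space: "space M = topspace T"
    using sets_eq_imp_space_eq[OF sets] by (simp add: space_borel_of)
  obtain X d where "Metric_space X d" and Td: "T = Metric_space.mtopology X d"
    using T(2) by (auto simp: completely_metrizable_space_def)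
  interpret Metric_space X d by fact
  obtain C where C: "countable C" "C \<subseteq> X" "mtopology closure_of C = X"
    using T(1) by (auto simp: separable_space_def Td)
  let ?\<A> = "insert {} ((\<lambda>(c, n). mball c (inverse (Suc n))) ` (C \<times> (UNIV :: nat set)))"
  let ?A = "from_nat_into ?\<A>"
  have cA: "countable ?\<A>"
    using C(1) by simp
  show thesis
  proof (rule that[of ?A])
    show "?A n \<in> sets M" for n
    proof -
      have "?A n \<in> ?\<A>"
        by (rule from_nat_into) simp
      then have "openin T (?A n)"
        by (auto simp: Td)
      then show ?thesis
        by (simp add: sets openin_imp_sets_borel_of)
    qed
    fix x y
    assume "x \<in> space M" "y \<in> space M" and ne: "x \<noteq> y"
    then have xy: "x \<in> X" "y \<in> X"
      by (auto simp: space Td)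
    then have "0 < d x y / 2"
      using ne by simp
    then obtain n where n: "inverse (real (Suc n)) < d x y / 2"
      using reals_Archimedean by blast
    have "x \<in> mtopology closure_of C"
      using C xy by simp
    then have "\<forall>r>0. \<exists>c\<in>C. c \<in> mball x r"
      unfolding metric_closure_of by blast
    moreover have "0 < inverse (real (Suc n))"
      by simp
    ultimately obtain c where c: "c \<in> C" "c \<in> mball x (inverse (Suc n))"
      by blast
    let ?B = "mball c (inverse (Suc n))"
    have "x \<in> ?B"
      using c xy by (auto simp: commute)
    moreover have "y \<notin> ?B"
      using triangle[of x c y] c xy n by (auto simp: commute)
    moreover obtain m where "?A m = ?B"
      using c(1) from_nat_into_surj[OF cA, of ?B] by auto
    ultimately show "\<exists>m. (x \<in> ?A m) \<noteq> (y \<in> ?A m)"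
      by metis
  qed
qed

text \<open>The colour of \<open>x\<close> is the first index \<open>n\<close> at which \<open>A n\<close> separates \<open>x\<close> from \<open>f x\<close>, together with
  the side on which \<open>x\<close> lies. If \<open>f x\<close> has the same index, then it lies on the other side.\<close>

lemma fixed_point_free_countable_colouring:
  fixes A :: "nat \<Rightarrow> 'a set"
  assumes A[measurable]: "\<And>n. A n \<in> sets M"
    and sep: "\<And>x y. \<lbrakk>x \<in> space M; y \<in> space M; x \<noteq> y\<rbrakk> \<Longrightarrow> \<exists>n. (x \<in> A n) \<noteq> (y \<in> A n)"
    and f[measurable]: "f \<in> M \<rightarrow>\<^sub>M M"
    and fix_free: "\<And>x. x \<in> space M \<Longrightarrow> f x \<noteq> x"
  obtains c :: "'a \<Rightarrow> nat" where "c \<in> M \<rightarrow>\<^sub>M count_space UNIV"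
    and "\<And>x. x \<in> space M \<Longrightarrow> c (f x) \<noteq> c x"
proof -
  define N where "N x = (LEAST n. (x \<in> A n) \<noteq> (f x \<in> A n))" for x
  define c :: "'a \<Rightarrow> nat" where "c x = 2 * N x + of_bool (x \<in> A (N x))" for x
  have N[measurable]: "N \<in> M \<rightarrow>\<^sub>M count_space UNIV"
    unfolding N_def by measurable
  have [measurable]: "Measurable.pred M (\<lambda>x. x \<in> A (N x))"
    by (rule measurable_compose_countable[OF _ N, of "\<lambda>n x. x \<in> A n"]) measurable
  show thesis
  proof (rule that)
    show "c \<in> M \<rightarrow>\<^sub>M count_space UNIV"
      unfolding c_def of_bool_def by measurable
    fix x
    assume x: "x \<in> space M"
    have N_sep: "(x \<in> A (N x)) \<noteq> (f x \<in> A (N x))"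
      unfolding N_def
      by (rule LeastI_ex) (metis sep x fix_free measurable_space[OF f])
    show "c (f x) \<noteq> c x"
    proof
      assume "c (f x) = c x"
      then have "c (f x) div 2 = c x div 2" "c (f x) mod 2 = c x mod 2"
        by simp_all
      then have "N (f x) = N x" "(f x \<in> A (N (f x))) = (x \<in> A (N x))"
        by (auto simp: c_def of_bool_def split: if_splits)
      then show False
        using N_sep by simp
    qed
  qed
qed

text \<open>The natural numbers admit no infinite descent, so an orbit cannot stay where each step lowers
  \<open>c\<close>.\<close>

lemma orbit_leaves_of_descent:
  fixes c :: "'a \<Rightarrow> nat"
  assumes "x \<in> E" "\<And>y. y \<in> E \<Longrightarrow> h y \<in> E" "\<And>y. \<lbrakk>y \<in> E; p y\<rbrakk> \<Longrightarrow> c (h y) < c y"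
  shows "\<exists>n. \<not> p ((h ^^ n) x)"
  using assms(1)
proof (induction "c x" arbitrary: x rule: less_induct)
  case less
  show ?case
  proof (cases "p x")
    case True
    then obtain n where "\<not> p ((h ^^ n) (h x))"
      using less assms(2,3) by blast
    then show ?thesis
      by (intro exI[of _ "Suc n"]) (simp add: funpow_swap1)
  next
    case False
    then show ?thesis
      by (intro exI[of _ 0]) simp
  qed
qed

text \<open>Call \<open>x\<close> an up point if \<open>c x < c (f x)\<close>. The set \<open>P\<close> consists of the up points, so it separates
  \<open>x\<close> from \<open>f x\<close> unless both have the same type. From a point that is not up, \<open>c\<close> falls along the forward
  orbit until an up point is reached; from an up point, \<open>c\<close> falls along the backward orbit as long as
  the points reached are up. Both searches end, and the length of the search changes by one between
  neighbours of the same type. The set \<open>Q\<close> records its parity. The direction of search must depend on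
  the type, because a run need not be finite in the direction in which \<open>c\<close> rises.\<close>

lemma invertible_four_colouring:
  fixes c :: "'a \<Rightarrow> nat"
  assumes f[measurable]: "f \<in> M \<rightarrow>\<^sub>M M" and g[measurable]: "g \<in> M \<rightarrow>\<^sub>M M"
    and c[measurable]: "c \<in> M \<rightarrow>\<^sub>M count_space UNIV"
    and gf: "\<And>x. x \<in> space M \<Longrightarrow> g (f x) = x"
    and fg: "\<And>x. x \<in> space M \<Longrightarrow> f (g x) = x"
    and col: "\<And>x. x \<in> space M \<Longrightarrow> c (f x) \<noteq> c x"
  obtains P Q where "P \<in> sets M" "Q \<in> sets M"
    and "\<And>x. x \<in> space M \<Longrightarrow> (f x \<in> P) \<noteq> (x \<in> P) \<or> (f x \<in> Q) \<noteq> (x \<in> Q)"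
proof -
  define up where "up x \<longleftrightarrow> c x < c (f x)" for x
  define ahead where "ahead x = (LEAST n. up ((f ^^ n) x))" for x
  define behind where "behind x = (LEAST n. \<not> up ((g ^^ n) x))" for x
  have fs: "f x \<in> space M" and gs: "g x \<in> space M" if "x \<in> space M" for x
    using that measurable_space f g by metis+
  have [measurable]: "f ^^ n \<in> M \<rightarrow>\<^sub>M M" "g ^^ n \<in> M \<rightarrow>\<^sub>M M" for n
    by (induction n) (auto intro: measurable_comp f g simp: id_def simp del: comp_apply)
  \<comment> \<open>The Borel sigma-algebra of the natural numbers contains all sets, and it is the one for
    which order comparisons are measurable in general.\<close>
  have [measurable]: "c \<in> borel_measurable M"
    by (rule measurable_compose[OF c, of "\<lambda>n. n"]) simp
  have [measurable]: "Measurable.pred M up"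
    unfolding up_def[abs_def] by measurable
  have [measurable]: "ahead \<in> M \<rightarrow>\<^sub>M count_space UNIV" "behind \<in> M \<rightarrow>\<^sub>M count_space UNIV"
    unfolding ahead_def[abs_def] behind_def[abs_def] by measurable
  have ahead_f: "ahead x = Suc (ahead (f x))" if x: "x \<in> space M" and "\<not> up x" for x
  proof -
    have "c (f y) < c y" if "y \<in> space M" "\<not> up y" for y
      using that col[of y] by (simp add: up_def)
    with x fs have "\<exists>n. \<not> \<not> up ((f ^^ n) x)"
      by (intro orbit_leaves_of_descent[where c = c and E = "space M"])
    then obtain n where "up ((f ^^ n) x)"
      by auto
    then show ?thesis
      unfolding ahead_def using that(2) Least_Suc[of "\<lambda>n. up ((f ^^ n) x)" n]
      by (simp add: funpow_swap1)
  qed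
  have behind_f: "behind (f x) = Suc (behind x)" if x: "x \<in> space M" and up: "up x" "up (f x)" for x
  proof -
    \<comment> \<open>The descent at \<open>y\<close> comes from its predecessor \<open>g y\<close> being up, so the search that ends is the
      one among the predecessors of the orbit points, one step further back.\<close>
    have "c (g y) < c y" if "y \<in> space M" "up (g y)" for y
      using that fg[of y] by (simp add: up_def)
    with x gs have "\<exists>n. \<not> up (g ((g ^^ n) x))"
      by (intro orbit_leaves_of_descent[where c = c and E = "space M" and p = "\<lambda>y. up (g y)"])
    then obtain n where "\<not> up (g ((g ^^ n) x))"
      by auto
    then have "\<not> up ((g ^^ (Suc (Suc n))) (f x))"
      using gf[OF x] by (simp add: funpow_swap1)
    then show ?thesis
      unfolding behind_def
      using up Least_Suc[of "\<lambda>n. \<not> up ((g ^^ n) (f x))" "Suc (Suc n)"] gf[OF x]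
      by (simp add: funpow_swap1)
  qed
  show thesis
  proof (rule that)
    show "{x \<in> space M. up x} \<in> sets M"
      by measurable
    show "{x \<in> space M. even (if up x then behind x else ahead x)} \<in> sets M"
      by measurable
    show "(f x \<in> {x \<in> space M. up x}) \<noteq> (x \<in> {x \<in> space M. up x}) \<or>
        (f x \<in> {x \<in> space M. even (if up x then behind x else ahead x)}) \<noteq>
        (x \<in> {x \<in> space M. even (if up x then behind x else ahead x)})" if "x \<in> space M" for x
      using that fs[OF that] ahead_f[OF that] behind_f[OF that] by auto
  qed
qed

section \<open>A closed condition that forces freeness\<close>

lemma closedin_bernoulli_coordinate:
  assumes "\<gamma> \<in> carrier \<Gamma>"
  shows "closedin (bernoulli_topology \<Gamma>) {\<rho> \<in> topspace (bernoulli_topology \<Gamma>). \<rho> \<gamma> n = b}"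
proof -
  have "continuous_map (bernoulli_topology \<Gamma>) cantor_topology (\<lambda>\<rho>. \<rho> \<gamma>)"
    unfolding bernoulli_topology_def using assms by (rule continuous_map_product_projection)
  moreover have "continuous_map cantor_topology (discrete_topology UNIV) (\<lambda>a. a n)"
    unfolding cantor_topology_def by (rule continuous_map_product_projection) simp
  ultimately have cont: "continuous_map (bernoulli_topology \<Gamma>) (discrete_topology UNIV) (\<lambda>\<rho>. \<rho> \<gamma> n)"
    using continuous_map_compose by (fastforce simp: o_def)
  show "closedin (bernoulli_topology \<Gamma>) {\<rho> \<in> topspace (bernoulli_topology \<Gamma>). \<rho> \<gamma> n = b}"
    using closedin_continuous_map_preimage[OF cont, of "{b}"] by simp
qed

text \<open>The finite set \<open>N\<close> is chosen before \<open>\<rho>\<close>. Hence the condition on \<open>\<rho>\<close> is a finite union of clopen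
  sets and passes to limits; with \<open>N\<close> infinite it would in general only be open. On a limit it refutes
  \<open>shift \<Gamma> \<delta> \<rho> = \<rho>\<close> at the identity.\<close>

lemma closure_of_subset_free_part:
  assumes \<Gamma>: "group \<Gamma>"
    and Y: "Y \<subseteq> topspace (bernoulli_topology \<Gamma>)"
    and witness: "\<And>\<delta>. \<lbrakk>\<delta> \<in> carrier \<Gamma>; \<delta> \<noteq> \<one>\<^bsub>\<Gamma>\<^esub>\<rbrakk> \<Longrightarrow>
      \<exists>N. finite N \<and> (\<forall>\<rho>\<in>Y. \<exists>n\<in>N. \<rho> \<delta> n \<noteq> \<rho> \<one>\<^bsub>\<Gamma>\<^esub> n)"
  shows "bernoulli_topology \<Gamma> closure_of Y \<subseteq> free_part \<Gamma>"
proof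
  interpret group \<Gamma> by (rule \<Gamma>)
  let ?T = "bernoulli_topology \<Gamma>"
  fix \<rho>
  assume \<rho>: "\<rho> \<in> ?T closure_of Y"
  show "\<rho> \<in> free_part \<Gamma>"
    unfolding free_part_def
  proof (intro CollectI conjI ballI impI)
    show "\<rho> \<in> topspace ?T"
      using \<rho> by (simp add: in_closure_of)
    fix \<delta>
    assume \<delta>: "\<delta> \<in> carrier \<Gamma>" and fixed: "shift \<Gamma> \<delta> \<rho> = \<rho>"
    show "\<delta> = \<one>\<^bsub>\<Gamma>\<^esub>"
    proof (rule ccontr)
      assume "\<delta> \<noteq> \<one>\<^bsub>\<Gamma>\<^esub>"
      then obtain N where N: "finite N" "\<And>\<rho>. \<rho> \<in> Y \<Longrightarrow> \<exists>n\<in>N. \<rho> \<delta> n \<noteq> \<rho> \<one>\<^bsub>\<Gamma>\<^esub> n"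
        using witness[OF \<delta>] by blast
      let ?cyl = "\<lambda>\<gamma> n b. {\<rho> \<in> topspace ?T. \<rho> \<gamma> n = b}"
      let ?K = "\<Union>n\<in>N. \<Union>b\<in>UNIV. ?cyl \<delta> n b \<inter> ?cyl \<one>\<^bsub>\<Gamma>\<^esub> n (\<not> b)"
      have "closedin ?T (\<Union>b\<in>UNIV. ?cyl \<delta> n b \<inter> ?cyl \<one>\<^bsub>\<Gamma>\<^esub> n (\<not> b))" for n
        using \<delta> by (intro closedin_Union) (auto intro!: closedin_bernoulli_coordinate closedin_Int)
      then have "closedin ?T ?K"
        using N(1) by (intro closedin_Union) auto
      moreover have "Y \<subseteq> ?K"
        using Y N(2) by fastforce
      ultimately have "?T closure_of Y \<subseteq> ?K"
        by (intro closure_of_minimal)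
      then have "\<rho> \<in> ?K"
        using \<rho> by (rule subsetD)
      then obtain n where "\<rho> \<delta> n \<noteq> \<rho> \<one>\<^bsub>\<Gamma>\<^esub> n"
        by auto
      moreover have "shift \<Gamma> \<delta> \<rho> \<one>\<^bsub>\<Gamma>\<^esub> = \<rho> \<delta>"
        using \<delta> by (simp add: shift_def)
      ultimately show False
        using fixed by simp
    qed
  qed
qed

section \<open>The equivariant embedding\<close>

theorem proposition1p1:
  fixes \<Gamma> :: "('g, 'b) monoid_scheme"
    and M :: "'a measure"
    and \<beta> :: "'g \<Rightarrow> 'a \<Rightarrow> 'a"
  assumes "group \<Gamma>"
    and "countable (carrier \<Gamma>)"
    and "infinite (carrier \<Gamma>)"
    and "standard_borel M"
    and "borel_action \<Gamma> M \<beta>"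
    and "free_action \<Gamma> (space M) \<beta>"
  shows "\<exists>\<Psi>. \<Psi> \<in> M \<rightarrow>\<^sub>M restrict_space (borel_of (bernoulli_topology \<Gamma>)) (free_part \<Gamma>)
           \<and> inj_on \<Psi> (space M)
           \<and> (\<forall>\<gamma>\<in>carrier \<Gamma>. \<forall>x\<in>space M. \<Psi> (\<beta> \<gamma> x) = shift \<Gamma> \<gamma> (\<Psi> x))
           \<and> bernoulli_topology \<Gamma> closure_of (\<Psi> ` space M) \<subseteq> free_part \<Gamma>"
proof -
  interpret group \<Gamma> by fact
  interpret group_action \<Gamma> "space M" \<beta>
    using assms(5) by (simp add: borel_action_def)
  let ?T = "bernoulli_topology \<Gamma>"
  have \<beta>_meas[measurable]: "\<beta> \<gamma> \<in> M \<rightarrow>\<^sub>M M" if "\<gamma> \<in> carrier \<Gamma>" for \<gamma>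
  proof -
    have "(\<lambda>(\<gamma>, x). \<beta> \<gamma> x) \<circ> Pair \<gamma> \<in> M \<rightarrow>\<^sub>M M"
      using assms(5) that
      by (intro measurable_comp[OF measurable_Pair1']) (auto simp: borel_action_def)
    then show ?thesis
      by (simp add: o_def)
  qed
  have \<beta>_one: "\<beta> \<one>\<^bsub>\<Gamma>\<^esub> x = x" if "x \<in> space M" for x
    using that id_eq_one by (metis restrict_apply')
  obtain A :: "nat \<Rightarrow> 'a set" where A: "\<And>n. A n \<in> sets M"
    and sep: "\<And>x y. \<lbrakk>x \<in> space M; y \<in> space M; x \<noteq> y\<rbrakk> \<Longrightarrow> \<exists>n. (x \<in> A n) \<noteq> (y \<in> A n)"
    using standard_borel_separating_sequence[OF assms(4)] by metis
  define \<Delta> where "\<Delta> = carrier \<Gamma> - {\<one>\<^bsub>\<Gamma>\<^esub>}"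
  have "\<exists>P Q. P \<in> sets M \<and> Q \<in> sets M \<and>
      (\<forall>x\<in>space M. (\<beta> \<delta> x \<in> P) \<noteq> (x \<in> P) \<or> (\<beta> \<delta> x \<in> Q) \<noteq> (x \<in> Q))" if "\<delta> \<in> \<Delta>" for \<delta>
  proof -
    have \<delta>: "\<delta> \<in> carrier \<Gamma>" "\<delta> \<noteq> \<one>\<^bsub>\<Gamma>\<^esub>"
      using that by (auto simp: \<Delta>_def)
    then have "\<beta> \<delta> x \<noteq> x" if "x \<in> space M" for x
      using assms(6) that by (auto simp: free_action_def)
    then obtain c :: "'a \<Rightarrow> nat" where c: "c \<in> M \<rightarrow>\<^sub>M count_space UNIV"
        "\<And>x. x \<in> space M \<Longrightarrow> c (\<beta> \<delta> x) \<noteq> c x"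
      using fixed_point_free_countable_colouring[OF A sep \<beta>_meas[OF \<delta>(1)]] by blast
    have inv: "\<beta> (inv\<^bsub>\<Gamma>\<^esub> \<delta>) (\<beta> \<delta> x) = x" "\<beta> \<delta> (\<beta> (inv\<^bsub>\<Gamma>\<^esub> \<delta>) x) = x"
      if "x \<in> space M" for x
      using that \<delta>(1) \<beta>_one composition_rule[of x "inv\<^bsub>\<Gamma>\<^esub> \<delta>" \<delta>]
        composition_rule[of x \<delta> "inv\<^bsub>\<Gamma>\<^esub> \<delta>"] by simp_all
    show ?thesis
      using invertible_four_colouring[OF \<beta>_meas[OF \<delta>(1)] \<beta>_meas[OF inv_closed[OF \<delta>(1)]] c(1) inv c(2)]
      by metis
  qed
  then obtain P Q where PQ: "\<And>\<delta>. \<delta> \<in> \<Delta> \<Longrightarrow> P \<delta> \<in> sets M" "\<And>\<delta>. \<delta> \<in> \<Delta> \<Longrightarrow> Q \<delta> \<in> sets M"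
      "\<And>\<delta> x. \<lbrakk>\<delta> \<in> \<Delta>; x \<in> space M\<rbrakk> \<Longrightarrow>
         (\<beta> \<delta> x \<in> P \<delta>) \<noteq> (x \<in> P \<delta>) \<or> (\<beta> \<delta> x \<in> Q \<delta>) \<noteq> (x \<in> Q \<delta>)"
    by metis
  \<comment> \<open>The bits of the label of a point are its memberships in the separating sets, for
    injectivity, and in both sets of the colouring for each \<open>\<delta>\<close>, for freeness.\<close>
  define \<F> where "\<F> = range A \<union> P ` \<Delta> \<union> Q ` \<Delta>"
  define F where "F = from_nat_into \<F>"
  have "countable \<F>" "\<F> \<noteq> {}"
    using assms(2) by (auto simp: \<F>_def \<Delta>_def)
  then have F_range: "range F = \<F>"
    by (simp add: F_def)
  have "\<F> \<subseteq> sets M"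
    using A PQ(1,2) by (auto simp: \<F>_def)
  then have F[measurable]: "F n \<in> sets M" for n
    using F_range by blast
  define \<Psi> where "\<Psi> x = (\<lambda>\<gamma>\<in>carrier \<Gamma>. \<lambda>n. \<beta> \<gamma> x \<in> F n)" for x
  have meas: "\<Psi> \<in> M \<rightarrow>\<^sub>M borel_of ?T"
  proof (rule measurable_borel_of_bernoulli[OF assms(2)])
    fix \<gamma> n
    assume \<gamma>: "\<gamma> \<in> carrier \<Gamma>"
    then have [measurable]: "\<beta> \<gamma> \<in> M \<rightarrow>\<^sub>M M"
      by (rule \<beta>_meas)
    show "Measurable.pred M (\<lambda>x. \<Psi> x \<gamma> n)"
      using \<gamma> by (simp add: \<Psi>_def)
  qed (simp add: \<Psi>_def)
  have closure: "?T closure_of (\<Psi> ` space M) \<subseteq> free_part \<Gamma>"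
  proof (rule closure_of_subset_free_part[OF assms(1)])
    show "\<Psi> ` space M \<subseteq> topspace ?T"
      using measurable_space[OF meas] by (auto simp: space_borel_of)
    fix \<delta>
    assume \<delta>: "\<delta> \<in> carrier \<Gamma>" "\<delta> \<noteq> \<one>\<^bsub>\<Gamma>\<^esub>"
    then have \<delta>': "\<delta> \<in> \<Delta>"
      by (simp add: \<Delta>_def)
    then have "P \<delta> \<in> range F" "Q \<delta> \<in> range F"
      by (auto simp: F_range \<F>_def)
    then obtain m n where mn: "P \<delta> = F m" "Q \<delta> = F n"
      by auto
    show "\<exists>N. finite N \<and> (\<forall>\<rho>\<in>\<Psi> ` space M. \<exists>n\<in>N. \<rho> \<delta> n \<noteq> \<rho> \<one>\<^bsub>\<Gamma>\<^esub> n)"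
      using PQ(3)[OF \<delta>'] \<delta> \<beta>_one by (intro exI[of _ "{m, n}"]) (auto simp: \<Psi>_def mn)
  qed
  have "\<Psi> ` space M \<subseteq> free_part \<Gamma>"
    using closure closure_of_subset[of "\<Psi> ` space M" ?T] measurable_space[OF meas]
    by (auto simp: space_borel_of)
  then have "\<Psi> \<in> M \<rightarrow>\<^sub>M restrict_space (borel_of ?T) (free_part \<Gamma>)"
    using meas by (intro measurable_restrict_space2) auto
  moreover have "inj_on \<Psi> (space M)"
  proof (rule inj_onI, rule ccontr)
    fix x y
    assume xy: "x \<in> space M" "y \<in> space M" "\<Psi> x = \<Psi> y" "x \<noteq> y"
    then obtain k where k: "(x \<in> A k) \<noteq> (y \<in> A k)"
      using sep by blast
    have "A k \<in> range F"
      by (auto simp: F_range \<F>_def)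
    then obtain n where "A k = F n"
      by auto
    moreover have "\<Psi> x \<one>\<^bsub>\<Gamma>\<^esub> n = \<Psi> y \<one>\<^bsub>\<Gamma>\<^esub> n"
      using xy by simp
    ultimately show False
      using k xy \<beta>_one by (simp add: \<Psi>_def)
  qed
  moreover have "\<Psi> (\<beta> \<gamma> x) = shift \<Gamma> \<gamma> (\<Psi> x)" if "\<gamma> \<in> carrier \<Gamma>" "x \<in> space M" for \<gamma> x
    using that composition_rule by (auto simp: \<Psi>_def shift_def fun_eq_iff)
  ultimately show ?thesis
    using closure by blast
qed

end
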